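(* For fixed quaternionic imaginary units $\mathbf{c}_1,\mathbf{c}_2$ with $\mathbf{c}_2\neq\pm\mathbf{c}_1$, and for $\phi_1,\phi_2\in\mathbb{R}$ and $\delta_1,\delta_2\in[0,\pi]$, the product \[ C(\mathbf{c}_1,\phi_1,\delta_1)\otimes C(\mathbf{c}_2,\phi_2,\delta_2)\subset S^3 \] is an immersed $2$-surface in $\mathbb{H}$, possibly with boundary. The smallest unit quaternion spherical cap $U(\exp(\phi_1\mathbf{c}_1)\exp(\phi_2\mathbf{c}_2),\eta)$ that includes this product has $\eta:=\arccos(r)$, where \[ r:=\min_{|s|\le\delta_1,\ |t|\le\delta_2}\bigl(\cos s\cos t-\sin s\sin t\,\langle\mathbf{c}_1,\mathbf{c}_2\rangle\bigr). \] Moreover, if neither $\delta_1$ nor $\delta_2$ is equal to $\pi$, and at least one of them is less than $\tfrac12\pi$, then $C(\mathbf{c}_1,\phi_1,\delta_1)\otimes C(\mathbf{c}_2,\phi_2,\delta_2)\subset S^3$ is an embedded $2$-surface in $\mathbb{H}$, with boundary. Its boundary consists of four circular arcs which have pairwise intersections at the four points \[ \exp((\phi_1\pm\delta_1)\mathbf{c}_1)\exp((\phi_2\pm\delta_2)\mathbf{c}_2),\qquad \exp((\phi_1\pm\delta_1)\mathbf{c}_1)\exp((\phi_2\mp\delta_2)\mathbf{c}_2). \]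
   Context: $\mathbb{H}$ denotes the real quaternions, identified with $\mathbb{R}^4$ with its Euclidean inner product $\langle\cdot,\cdot\rangle$, and $S^3\subset\mathbb{H}$ is the set of unit quaternions. A quaternionic imaginary unit is a purely imaginary quaternion of norm $1$. For such $\mathbf{c}$ and $s\in\mathbb{R}$, $\exp(s\,\mathbf{c})=\cos s+\sin s\,\mathbf{c}$. For $\phi\in\mathbb{R}$ and $\delta\in[0,\pi]$, $C(\mathbf{c},\phi,\delta):=\{\exp(s\,\mathbf{c}):|s-\phi|\le\delta\}$. For subsets $A,B\subseteq\mathbb{H}$, the Minkowski product is $A\otimes B=\{ab:a\in A,\ b\in B\}$. For $\mathcal{P}\in S^3$ and $\eta\in[0,\pi]$, the unit quaternion spherical cap is $U(\mathcal{P},\eta):=\{\mathcal{U}\in S^3:\langle\mathcal{U},\mathcal{P}\rangle\ge\cos\eta\}$. The function $\arccos$ takes values in $[0,\pi]$. In expressions with several signs $\pm,\mp$, upper signs are taken together and lower signs are taken together.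
   Formalization: The immersed-surface, embedded-surface and boundary claims are stated only for δ₁, δ₂ > 0, since for δ₁ = 0 or δ₂ = 0 the product is a point, arc or circle and not a 2-surface; the inclusion in S³ and the cap claim cover all of [0,π]. *)

theory Defs
  imports "HOL-Analysis.Analysis"
begin

text \<open>
  The quaternion \<open>a + b i + c j + d k\<close> is the vector with the components \<open>a, b, c, d\<close> at the
  indices \<open>1, 2, 3, 4\<close>. The inner product and the norm are those of the library. The library
  multiplication \<open>*\<close> on vectors is componentwise, so the Hamilton product gets its own symbol.
\<close>

type_synonym quat = "real ^ 4"

definition qmult :: "quat \<Rightarrow> quat \<Rightarrow> quat" (infixl "\<cdot>" 70) where
  "x \<cdot> y = vector
     [x$1 * y$1 - x$2 * y$2 - x$3 * y$3 - x$4 * y$4,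
      x$1 * y$2 + x$2 * y$1 + x$3 * y$4 - x$4 * y$3,
      x$1 * y$3 - x$2 * y$4 + x$3 * y$1 + x$4 * y$2,
      x$1 * y$4 + x$2 * y$3 - x$3 * y$2 + x$4 * y$1]"

definition qone :: quat where
  "qone = vector [1, 0, 0, 0]"

definition imaginary_unit :: "quat \<Rightarrow> bool" where
  "imaginary_unit c \<longleftrightarrow> c$1 = 0 \<and> norm c = 1"

abbreviation S3 :: "quat set" where
  "S3 \<equiv> sphere 0 1"

text \<open>\<open>qexp s c\<close> is \<open>exp (s c)\<close>, for an imaginary unit \<open>c\<close>.\<close>

definition qexp :: "real \<Rightarrow> quat \<Rightarrow> quat" where
  "qexp s c = cos s *\<^sub>R qone + sin s *\<^sub>R c"

definition carc :: "quat \<Rightarrow> real \<Rightarrow> real \<Rightarrow> quat set" where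
  "carc c \<phi> \<delta> = {qexp s c | s. \<bar>s - \<phi>\<bar> \<le> \<delta>}"

definition minkowski_prod :: "quat set \<Rightarrow> quat set \<Rightarrow> quat set" (infixl "\<otimes>" 70) where
  "A \<otimes> B = {a \<cdot> b | a b. a \<in> A \<and> b \<in> B}"

definition sph_cap :: "quat \<Rightarrow> real \<Rightarrow> quat set" where
  "sph_cap P \<eta> = {U \<in> S3. U \<bullet> P \<ge> cos \<eta>}"

text \<open>Caps with the same centre are nested, so the smallest one is the one of least radius.\<close>

definition smallest_cap_radius :: "quat \<Rightarrow> quat set \<Rightarrow> real \<Rightarrow> bool" where
  "smallest_cap_radius P S \<eta> \<longleftrightarrow>
     \<eta> \<in> {0..pi} \<and> S \<subseteq> sph_cap P \<eta> \<and> (\<forall>\<eta>' \<in> {0..pi}. S \<subseteq> sph_cap P \<eta>' \<longrightarrow> \<eta> \<le> \<eta>')"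

definition circular_arc :: "'a::euclidean_space set \<Rightarrow> bool" where
  "circular_arc A \<longleftrightarrow>
     (\<exists>z u v \<rho> a b. norm u = 1 \<and> norm v = 1 \<and> u \<bullet> v = 0 \<and> 0 < \<rho> \<and> a < b \<and> b < a + 2 * pi \<and>
        A = {z + \<rho> *\<^sub>R (cos \<theta> *\<^sub>R u + sin \<theta> *\<^sub>R v) | \<theta>. \<theta> \<in> {a..b}})"

text \<open>\<open>Ck_on k f U\<close> is meant for open \<open>U\<close>.\<close>

primrec Ck_on :: "nat \<Rightarrow> ('a::euclidean_space \<Rightarrow> 'b::euclidean_space) \<Rightarrow> 'a set \<Rightarrow> bool" where
  "Ck_on 0 f U \<longleftrightarrow> continuous_on U f"
| "Ck_on (Suc k) f U \<longleftrightarrow>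
     (\<forall>x\<in>U. f differentiable (at x)) \<and>
     (\<forall>v. Ck_on k (\<lambda>x. frechet_derivative f (at x) v) U)"

definition smooth_on :: "('a::euclidean_space \<Rightarrow> 'b::euclidean_space) \<Rightarrow> 'a set \<Rightarrow> bool" where
  "smooth_on f U \<longleftrightarrow> (\<forall>k. Ck_on k f U)"

text \<open>
  The model for charts is the closed quadrant, so that surfaces may have boundary points and
  corners. Its relatively open subsets include copies of all small open subsets of the plane
  and of the half plane.
\<close>

definition quadrant :: "(real ^ 2) set" where
  "quadrant = {x. 0 \<le> x$1 \<and> 0 \<le> x$2}"

text \<open>
  As usual, smoothness on a relatively open subset \<open>W\<close> of the quadrant means that there is a
  smooth extension to an open set. The derivative of the extension at points of \<open>W\<close> does not
  depend on the extension.
\<close>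

definition local_immersion :: "(real ^ 2) set \<Rightarrow> (real ^ 2 \<Rightarrow> 'b::euclidean_space) \<Rightarrow> bool" where
  "local_immersion W h \<longleftrightarrow>
     (\<exists>U g. open U \<and> W \<subseteq> U \<and> smooth_on g U \<and>
        (\<forall>x\<in>W. g x = h x \<and> inj (frechet_derivative g (at x))))"

text \<open>
  \<open>M\<close> is a surface, possibly with boundary and corners, and \<open>f\<close> is an immersion of it: around
  every point of \<open>M\<close> there is a local parametrization \<open>\<psi>\<close> such that \<open>f \<circ> \<psi>\<close> is a smooth
  immersion. No compatibility of the charts has to be demanded: locally \<open>f \<circ> \<psi>\<close> has a
  smooth left inverse, so changes of charts are smooth, and the smooth structure of \<open>M\<close> is
  the one for which \<open>f\<close> is an immersion.
\<close>

definition surface_immersion ::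
    "'m::topological_space set \<Rightarrow> ('m \<Rightarrow> 'b::euclidean_space) \<Rightarrow> bool" where
  "surface_immersion M f \<longleftrightarrow>
     (\<forall>p\<in>M. \<exists>W \<psi> \<psi>'.
        openin (top_of_set quadrant) W \<and> openin (top_of_set M) (\<psi> ` W) \<and> p \<in> \<psi> ` W \<and>
        homeomorphism W (\<psi> ` W) \<psi> \<psi>' \<and> local_immersion W (f \<circ> \<psi>))"

text \<open>
  Every second countable Hausdorff surface with boundary is homeomorphic to a subspace of
  four-dimensional Euclidean space, so it is no restriction to take \<open>M\<close> there. Only the
  topology of \<open>M\<close> matters.
\<close>

definition immersed_surface :: "'b::euclidean_space set \<Rightarrow> bool" where
  "immersed_surface S \<longleftrightarrow>
     (\<exists>(M :: (real ^ 4) set) f. surface_immersion M f \<and> f ` M = S)"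

definition embedded_surface :: "'b::euclidean_space set \<Rightarrow> bool" where
  "embedded_surface S \<longleftrightarrow>
     (\<exists>(M :: (real ^ 4) set) f g. surface_immersion M f \<and> homeomorphism M S f g)"

text \<open>
  The boundary in the sense of manifolds (not the topological \<open>frontier\<close>): the points that
  have no neighbourhood in \<open>S\<close> homeomorphic to an open subset of the plane.
\<close>

definition surface_boundary :: "'b::euclidean_space set \<Rightarrow> 'b set" where
  "surface_boundary S =
     {p \<in> S. \<not> (\<exists>V (D :: (real ^ 2) set).
                  openin (top_of_set S) V \<and> p \<in> V \<and> open D \<and> V homeomorphic D)}"

end

theory Submission
  imports Defs
begin

text \<open>
  The product of the two arcs is the image of the rectangle with centre \<open>(\<phi>1, \<phi>2)\<close> and half sides
  \<open>\<delta>1\<close>, \<open>\<delta>2\<close> under the map \<open>(s, t) \<mapsto> exp (s c1) exp (t c2)\<close>, so every claim is a claim about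
  this map.

  The map is an immersion of the whole plane: its derivative sends \<open>(v, w)\<close> to
  \<open>exp (s c1) (v c1 + w c2) exp (t c2)\<close>, whose norm is that of \<open>v c1 + w c2\<close>, and \<open>c1\<close>, \<open>c2\<close> are
  linearly independent (\<open>qexp_surface_derivative_inj\<close>). A rectangle is covered by four charts, one
  for each corner, so its image is an immersed surface (\<open>immersed_surface_rectangle\<close>).

  Two parameter points have the same image exactly if they differ by multiples of \<open>2 \<pi>\<close> in both
  coordinates or by odd multiples of \<open>\<pi>\<close> in both. The conditions on \<open>\<delta>1\<close> and \<open>\<delta>2\<close> leave no room
  for either inside the rectangle, except for equal points (\<open>qexp_prod_inj\<close>). By compactness the
  map is then a homeomorphism from the rectangle to the product. Invariance of domain identifies
  the surface boundary with the image of the four sides (\<open>surface_boundary_homeomorphism\<close>). On a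
  side one factor is constant, and multiplication by a unit quaternion is an isometry, so each side
  is mapped to an arc of a unit circle; injectivity gives the intersections of these arcs.

  The same isometries give the cap: the inner product of \<open>exp ((\<phi>1 + s) c1) exp ((\<phi>2 + t) c2)\<close> with
  the centre equals that of \<open>exp (s c1) exp (t c2)\<close> with \<open>1\<close>, which is the function of \<open>s\<close> and \<open>t\<close>
  that is minimized (\<open>qexp_prod_inner_centre\<close>).
\<close>

section \<open>The Hamilton product\<close>

lemma vector_4 [simp]:
  "(vector [w, x, y, z] :: 'a::zero ^ 4) $ 1 = w" "(vector [w, x, y, z] :: 'a ^ 4) $ 2 = x"
  "(vector [w, x, y, z] :: 'a ^ 4) $ 3 = y" "(vector [w, x, y, z] :: 'a ^ 4) $ 4 = z"
  by (simp_all add: vector_def)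

lemma quat_eq_iff: "x = y \<longleftrightarrow> x$1 = y$1 \<and> x$2 = y$2 \<and> x$3 = y$3 \<and> x$4 = y$4"
  for x y :: quat
  by (simp add: vec_eq_iff forall_4)

lemma inner_quat: "x \<bullet> y = x$1 * y$1 + x$2 * y$2 + x$3 * y$3 + x$4 * y$4"
  for x y :: quat
  by (simp add: inner_vec_def sum_4)

lemma qmult_nth [simp]:
  "(x \<cdot> y)$1 = x$1 * y$1 - x$2 * y$2 - x$3 * y$3 - x$4 * y$4"
  "(x \<cdot> y)$2 = x$1 * y$2 + x$2 * y$1 + x$3 * y$4 - x$4 * y$3"
  "(x \<cdot> y)$3 = x$1 * y$3 - x$2 * y$4 + x$3 * y$1 + x$4 * y$2"
  "(x \<cdot> y)$4 = x$1 * y$4 + x$2 * y$3 - x$3 * y$2 + x$4 * y$1"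
  by (simp_all add: qmult_def)

lemma qone_nth [simp]: "qone$1 = 1" "qone$2 = 0" "qone$3 = 0" "qone$4 = 0"
  by (simp_all add: qone_def)

lemma qmult_assoc: "(x \<cdot> y) \<cdot> z = x \<cdot> (y \<cdot> z)"
  by (simp add: quat_eq_iff algebra_simps)

lemma qmult_one [simp]: "qone \<cdot> x = x" "x \<cdot> qone = x"
  by (simp_all add: quat_eq_iff)

lemma qmult_inner_left: "(p \<cdot> x) \<bullet> (p \<cdot> y) = (p \<bullet> p) * (x \<bullet> y)"
  by (simp add: inner_quat algebra_simps)

lemma qmult_inner_right: "(x \<cdot> p) \<bullet> (y \<cdot> p) = (p \<bullet> p) * (x \<bullet> y)"
  by (simp add: inner_quat algebra_simps)

lemma norm_qmult: "norm (x \<cdot> y) = norm x * norm y"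
  by (simp add: norm_eq_sqrt_inner qmult_inner_left real_sqrt_mult)

lemma bounded_bilinear_qmult: "bounded_bilinear qmult"
proof
  show "\<exists>K. \<forall>a b. norm (a \<cdot> b) \<le> norm a * norm b * K"
    by (rule exI[of _ 1]) (simp add: norm_qmult)
qed (simp_all add: quat_eq_iff algebra_simps)

lemmas qmult_distribs =
  bounded_bilinear.add_left[OF bounded_bilinear_qmult]
  bounded_bilinear.add_right[OF bounded_bilinear_qmult]
  bounded_bilinear.scaleR_left[OF bounded_bilinear_qmult]
  bounded_bilinear.scaleR_right[OF bounded_bilinear_qmult]
  bounded_bilinear.minus_right[OF bounded_bilinear_qmult]
  bounded_bilinear.diff_right[OF bounded_bilinear_qmult]

lemma imaginary_unit_inner:
  assumes "imaginary_unit c" shows "c \<bullet> c = 1"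
  using assms by (simp add: imaginary_unit_def norm_eq_1)

lemma imaginary_unit_inner_one:
  assumes "imaginary_unit c" shows "qone \<bullet> c = 0"
  using assms by (simp add: imaginary_unit_def inner_quat)

lemma imaginary_unit_square:
  assumes "imaginary_unit c" shows "c \<cdot> c = - qone"
proof -
  have "c$1 = 0" using assms by (simp add: imaginary_unit_def)
  with imaginary_unit_inner[OF assms] show ?thesis
    by (simp add: quat_eq_iff inner_quat algebra_simps)
qed

text \<open>
  Taking norms in the equation gives \<open>p = \<plusminus> q\<close>, so a nontrivial relation would make \<open>c2\<close> equal to
  \<open>c1\<close> or to \<open>- c1\<close>.
\<close>

lemma imaginary_units_independent:
  assumes "imaginary_unit c1" "imaginary_unit c2" "c2 \<noteq> c1" "c2 \<noteq> - c1"
    and eq: "p *\<^sub>R c1 = q *\<^sub>R c2"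
  shows "p = 0 \<and> q = 0"
proof -
  have "norm (p *\<^sub>R c1) = norm (q *\<^sub>R c2)" using eq by simp
  then have "\<bar>p\<bar> = \<bar>q\<bar>" using assms(1,2) by (simp add: imaginary_unit_def)
  then consider "p = q" | "p = - q" by linarith
  then show ?thesis
  proof cases
    case 1
    then show ?thesis using eq assms(3) by auto
  next
    case 2
    then have "q *\<^sub>R (c1 + c2) = q *\<^sub>R c1 + p *\<^sub>R c1" using eq by (simp add: algebra_simps)
    then have "q *\<^sub>R (c1 + c2) = 0" using 2 by simp
    then show ?thesis using 2 assms(4) by (auto simp: add_eq_0_iff)
  qed
qed

lemma norm_qexp:
  assumes "imaginary_unit c" shows "norm (qexp s c) = 1"
proof -
  have "qone \<bullet> qone = 1" by (simp add: inner_quat)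
  then have "qexp s c \<bullet> qexp s c = (cos s)\<^sup>2 + (sin s)\<^sup>2"
    using imaginary_unit_inner[OF assms] imaginary_unit_inner_one[OF assms]
    by (simp add: qexp_def inner_add_left inner_add_right inner_commute power2_eq_square)
  then show ?thesis by (simp add: norm_eq_1)
qed

lemma qexp_add:
  assumes "imaginary_unit c" shows "qexp (s + t) c = qexp s c \<cdot> qexp t c"
proof -
  have "qexp s c \<cdot> qexp t c
      = (cos s * cos t) *\<^sub>R qone + (cos s * sin t) *\<^sub>R c + ((sin s * cos t) *\<^sub>R c - (sin s * sin t) *\<^sub>R qone)"
    by (simp add: qexp_def qmult_distribs imaginary_unit_square[OF assms] algebra_simps)
  also have "\<dots> = qexp (s + t) c"
    by (simp add: qexp_def cos_add sin_add algebra_simps)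
  finally show ?thesis by simp
qed

lemma qexp_0 [simp]: "qexp 0 c = qone"
  by (simp add: qexp_def)

lemma qexp_inner_qone:
  assumes "imaginary_unit c1" "imaginary_unit c2"
  shows "(qexp s c1 \<cdot> qexp t c2) \<bullet> qone = cos s * cos t - sin s * sin t * (c1 \<bullet> c2)"
  using assms by (simp add: imaginary_unit_def qexp_def inner_quat algebra_simps)

text \<open>
  The outer factors \<open>exp (a c1)\<close> on the left and \<open>exp (b c2)\<close> on the right are common to both
  arguments and act as isometries, so only the real part of \<open>exp (s c1) exp (t c2)\<close> is left.
\<close>

lemma qexp_prod_inner_centre:
  assumes "imaginary_unit c1" "imaginary_unit c2"
  shows "(qexp (a + s) c1 \<cdot> qexp (b + t) c2) \<bullet> (qexp a c1 \<cdot> qexp b c2)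
    = cos s * cos t - sin s * sin t * (c1 \<bullet> c2)"
proof -
  have 1: "qexp (a + s) c1 \<cdot> qexp (b + t) c2
      = qexp a c1 \<cdot> ((qexp s c1 \<cdot> qexp t c2) \<cdot> qexp b c2)"
    using qexp_add[OF assms(1), of a s] qexp_add[OF assms(2), of t b]
    by (simp add: qmult_assoc add.commute)
  have 2: "qexp a c1 \<cdot> qexp b c2 = qexp a c1 \<cdot> (qone \<cdot> qexp b c2)" by simp
  have "qexp a c1 \<bullet> qexp a c1 = 1" "qexp b c2 \<bullet> qexp b c2 = 1"
    using norm_qexp assms by (simp_all add: norm_eq_1)
  then show ?thesis unfolding 1 2 qmult_inner_left qmult_inner_right
    by (simp add: qexp_inner_qone[OF assms])
qed

section \<open>Injectivity of the parametrization\<close>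

text \<open>
  Cancelling outer factors turns the equation into \<open>exp (x c1) = exp (y c2)\<close> with \<open>x = s - s'\<close> and
  \<open>y = t' - t\<close>. The imaginary parts and the independence of \<open>c1\<close>, \<open>c2\<close> give \<open>sin x = sin y = 0\<close>,
  the real parts \<open>cos x = cos y\<close>: both differences vanish or both have absolute value \<open>\<pi>\<close>, and the
  last hypothesis excludes the second case.
\<close>

lemma qexp_prod_inj:
  assumes c: "imaginary_unit c1" "imaginary_unit c2" "c2 \<noteq> c1" "c2 \<noteq> - c1"
    and eq: "qexp s c1 \<cdot> qexp t c2 = qexp s' c1 \<cdot> qexp t' c2"
    and s: "\<bar>s - s'\<bar> < 2 * pi" and t: "\<bar>t - t'\<bar> < 2 * pi"
    and st: "\<bar>s - s'\<bar> < pi \<or> \<bar>t - t'\<bar> < pi"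
  shows "s = s' \<and> t = t'"
proof -
  define x where "x = s - s'"
  define y where "y = t' - t"
  have "qexp (- s') c1 \<cdot> ((qexp s c1 \<cdot> qexp t c2) \<cdot> qexp (- t) c2)
      = qexp (- s') c1 \<cdot> ((qexp s' c1 \<cdot> qexp t' c2) \<cdot> qexp (- t) c2)"
    by (simp add: eq)
  then have "(qexp (- s') c1 \<cdot> qexp s c1) \<cdot> (qexp t c2 \<cdot> qexp (- t) c2)
      = (qexp (- s') c1 \<cdot> qexp s' c1) \<cdot> (qexp t' c2 \<cdot> qexp (- t) c2)"
    by (simp only: qmult_assoc)
  then have xy: "qexp x c1 = qexp y c2"
    by (simp add: qexp_add[OF c(1), symmetric] qexp_add[OF c(2), symmetric] x_def y_def
        del: add_uminus_conv_diff) (simp add: add.commute)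
  have c1: "c1$1 = 0" and c2: "c2$1 = 0" using c by (simp_all add: imaginary_unit_def)
  have cos: "cos x = cos y" using arg_cong[OF xy, of "\<lambda>q. q$1"] c1 c2 by (simp add: qexp_def)
  then have "sin x *\<^sub>R c1 = sin y *\<^sub>R c2" using xy by (simp add: qexp_def)
  then have sin: "sin x = 0" "sin y = 0" using imaginary_units_independent[OF c] by blast+
  have *: "z = 0 \<or> \<bar>z\<bar> = pi" if "sin z = 0" "\<bar>z\<bar> < 2 * pi" for z :: real
  proof -
    obtain i :: int where i: "z = of_int i * pi" using \<open>sin z = 0\<close> sin_zero_iff_int2 by blast
    then have "of_int \<bar>i\<bar> * pi < 2 * pi" using that(2) by (simp add: abs_mult)
    then have "\<bar>i\<bar> < 2" by simp
    then have "i = 0 \<or> i = 1 \<or> i = -1" by linarith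
    then show ?thesis using i by auto
  qed
  have **: "cos z = - 1" if "\<bar>z\<bar> = pi" for z :: real
    using cos_abs_real[of z] that by simp
  have "x = 0 \<or> \<bar>x\<bar> = pi" "y = 0 \<or> \<bar>y\<bar> = pi"
    using *[OF sin(1)] *[OF sin(2)] s t by (auto simp: x_def y_def abs_minus_commute)
  then have "x = 0 \<and> y = 0 \<or> \<bar>x\<bar> = pi \<and> \<bar>y\<bar> = pi"
    using cos ** by fastforce
  then show ?thesis using st by (auto simp: x_def y_def abs_minus_commute)
qed

section \<open>Smoothness\<close>

text \<open>
  By the chain rule the derivative of the composite in direction \<open>v\<close> is the derivative of \<open>f\<close> in the
  fixed direction \<open>A v\<close>, composed with the same affine map, so the induction over \<open>k\<close> closes.
\<close>

lemma Ck_on_affine: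
  assumes A: "bounded_linear A" and f: "Ck_on k f UNIV"
  shows "Ck_on k (\<lambda>x. f (c + A x)) UNIV"
  using f
proof (induction k arbitrary: f)
  case 0
  have "continuous_on UNIV (\<lambda>x. c + A x)"
    by (intro continuous_intros bounded_linear.continuous_on[OF A])
  then show ?case using 0 by (auto intro: continuous_on_compose2)
next
  case (Suc k)
  have d: "((\<lambda>x. f (c + A x)) has_derivative (\<lambda>v. frechet_derivative f (at (c + A x)) (A v))) (at x)"
    for x
  proof -
    have "((\<lambda>x. c + A x) has_derivative A) (at x)"
      by (auto intro!: derivative_eq_intros bounded_linear.has_derivative[OF A])
    moreover have "(f has_derivative frechet_derivative f (at (c + A x))) (at (c + A x))"
      using Suc.prems by (simp add: frechet_derivative_works[symmetric])
    ultimately show ?thesis using has_derivative_compose by blast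
  qed
  then have "frechet_derivative (\<lambda>x. f (c + A x)) (at x) v
      = frechet_derivative f (at (c + A x)) (A v)" for x v
    by (simp add: frechet_derivative_at[OF d, symmetric])
  moreover have "Ck_on k (\<lambda>x. frechet_derivative f (at (c + A x)) (A v)) UNIV" for v
    using Suc.IH[of "\<lambda>y. frechet_derivative f (at y) (A v)"] Suc.prems by simp
  ultimately show ?case using differentiableI[OF d] by simp
qed

text \<open>
  A family of functions that is closed under directional derivatives: differentiation only changes
  the four coefficients. The smoothness of all its members therefore follows by a single induction.
\<close>

definition trig_comb :: "'b \<Rightarrow> 'b \<Rightarrow> 'b \<Rightarrow> 'b \<Rightarrow> real ^ 2 \<Rightarrow> 'b::euclidean_space" where
  "trig_comb P Q R S x =
     (cos (x$1) * cos (x$2)) *\<^sub>R P + (sin (x$1) * cos (x$2)) *\<^sub>R Q +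
     (cos (x$1) * sin (x$2)) *\<^sub>R R + (sin (x$1) * sin (x$2)) *\<^sub>R S"

lemma trig_comb_has_derivative:
  "(trig_comb P Q R S has_derivative
     (\<lambda>v. trig_comb (v$1 *\<^sub>R Q + v$2 *\<^sub>R R) (v$2 *\<^sub>R S - v$1 *\<^sub>R P)
            (v$1 *\<^sub>R S - v$2 *\<^sub>R P) (- (v$1 *\<^sub>R R) - v$2 *\<^sub>R Q) x)) (at x)"
  unfolding trig_comb_def
  by (rule derivative_eq_intros bounded_linear.has_derivative[OF bounded_linear_vec_nth]
        has_derivative_ident refl)+ (simp add: fun_eq_iff algebra_simps)

lemma smooth_trig_comb: "smooth_on (trig_comb P Q R S) UNIV"
proof -
  have "Ck_on k (trig_comb P Q R S) UNIV" for k
  proof (induction k arbitrary: P Q R S)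
    case 0
    show ?case
      by (simp add: continuous_on_eq_continuous_at
          has_derivative_continuous[OF trig_comb_has_derivative])
  next
    case (Suc k)
    then show ?case
      by (simp add: differentiableI[OF trig_comb_has_derivative]
          frechet_derivative_at[OF trig_comb_has_derivative, symmetric])
  qed
  then show ?thesis by (simp add: smooth_on_def)
qed

definition qexp_surface :: "quat \<Rightarrow> quat \<Rightarrow> real ^ 2 \<Rightarrow> quat" where
  "qexp_surface c1 c2 x = qexp (x$1) c1 \<cdot> qexp (x$2) c2"

lemma qexp_surface_eq_trig_comb: "qexp_surface c1 c2 = trig_comb qone c1 c2 (c1 \<cdot> c2)"
  by (rule ext) (simp add: qexp_surface_def trig_comb_def qexp_def qmult_distribs algebra_simps)

lemma smooth_qexp_surface: "smooth_on (qexp_surface c1 c2) UNIV"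
  unfolding qexp_surface_eq_trig_comb by (rule smooth_trig_comb)

text \<open>
  The derivative at \<open>x\<close> maps \<open>v\<close> to \<open>v$1 c1 + v$2 c2\<close>, multiplied on both sides by unit
  quaternions. These preserve the norm, so the kernel is trivial.
\<close>

lemma qexp_surface_derivative_inj:
  assumes c: "imaginary_unit c1" "imaginary_unit c2" "c2 \<noteq> c1" "c2 \<noteq> - c1"
  shows "inj (frechet_derivative (qexp_surface c1 c2) (at x))"
proof -
  let ?D = "frechet_derivative (qexp_surface c1 c2) (at x)"
  have d: "(qexp_surface c1 c2 has_derivative (\<lambda>v. trig_comb (v$1 *\<^sub>R c1 + v$2 *\<^sub>R c2)
            (v$2 *\<^sub>R (c1 \<cdot> c2) - v$1 *\<^sub>R qone)
            (v$1 *\<^sub>R (c1 \<cdot> c2) - v$2 *\<^sub>R qone) (- (v$1 *\<^sub>R c2) - v$2 *\<^sub>R c1) x)) (at x)"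
    unfolding qexp_surface_eq_trig_comb by (rule trig_comb_has_derivative)
  have lin: "linear ?D"
    using frechet_derivative_at[OF d] d has_derivative_linear by metis
  have D: "?D v = qexp (x$1) c1 \<cdot> ((v$1 *\<^sub>R c1 + v$2 *\<^sub>R c2) \<cdot> qexp (x$2) c2)" for v
  proof -
    have s1: "c1 \<cdot> c1 = - qone" "c2 \<cdot> c2 = - qone" "c1 \<cdot> (c1 \<cdot> c2) = - c2"
      using c by (simp_all add: imaginary_unit_square qmult_assoc[symmetric]
          bounded_bilinear.minus_left[OF bounded_bilinear_qmult])
    show ?thesis unfolding frechet_derivative_at[OF d, symmetric]
      by (simp add: trig_comb_def qexp_def qmult_distribs s1 algebra_simps)
  qed
  have "v = 0" if "?D v = 0" for v
  proof -
    have "norm (?D v) = norm (v$1 *\<^sub>R c1 + v$2 *\<^sub>R c2)"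
      using c by (simp add: D norm_qmult norm_qexp)
    then have "v$1 *\<^sub>R c1 = (- v$2) *\<^sub>R c2"
      using that by (simp add: add_eq_0_iff)
    then show ?thesis
      using imaginary_units_independent[OF c] by (fastforce simp: vec_eq_iff forall_2)
  qed
  then show ?thesis using lin linear_injective_0 by blast
qed

section \<open>Images of a rectangle as surfaces\<close>

text \<open>
  The chart that carries the corner \<open>0\<close> of the quadrant to a corner of the rectangle with opposite
  vertices \<open>a\<close> and \<open>b\<close>: for each coordinate \<open>\<sigma>\<close> tells whether to start from the lower end \<open>a\<close>, going
  up, or from the upper end \<open>b\<close>, going down.
\<close>

definition corner_chart :: "real ^ 2 \<Rightarrow> real ^ 2 \<Rightarrow> (2 \<Rightarrow> bool) \<Rightarrow> real ^ 2 \<Rightarrow> real ^ 2" where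
  "corner_chart a b \<sigma> x = (\<chi> i. if \<sigma> i then a$i + x$i else b$i - x$i)"

definition corner_chart_inv :: "real ^ 2 \<Rightarrow> real ^ 2 \<Rightarrow> (2 \<Rightarrow> bool) \<Rightarrow> real ^ 2 \<Rightarrow> real ^ 2" where
  "corner_chart_inv a b \<sigma> y = (\<chi> i. if \<sigma> i then y$i - a$i else b$i - y$i)"

text \<open>
  The abstract surface of an immersion has to live in \<open>real ^ 4\<close>, so the rectangle is put there.
\<close>

definition plane_embedding :: "real ^ 2 \<Rightarrow> real ^ 4" where
  "plane_embedding x = vector [x$1, x$2, 0, 0]"

definition plane_projection :: "real ^ 4 \<Rightarrow> real ^ 2" where
  "plane_projection z = vector [z$1, z$2]"

lemma plane_projection_embedding [simp]: "plane_projection (plane_embedding x) = x"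
  by (simp add: plane_projection_def plane_embedding_def vec_eq_iff forall_2)

lemma continuous_on_plane_embedding: "continuous_on A plane_embedding"
  unfolding plane_embedding_def
  by (rule linear_continuous_on, rule linear_conv_bounded_linear[THEN iffD1], rule linearI)
    (simp_all add: vec_eq_iff forall_4)

lemma continuous_on_plane_projection: "continuous_on A plane_projection"
  unfolding plane_projection_def
  by (rule linear_continuous_on, rule linear_conv_bounded_linear[THEN iffD1], rule linearI)
    (simp_all add: vec_eq_iff forall_2)

lemma corner_chart_affine:
  obtains A c where "bounded_linear A" "inj A" "corner_chart a b \<sigma> = (\<lambda>x. c + A x)"
proof
  let ?A = "\<lambda>x :: real^2. (\<chi> i. if \<sigma> i then x$i else - x$i) :: real^2"
  show "bounded_linear ?A"
    by (rule linear_conv_bounded_linear[THEN iffD1], rule linearI) (simp_all add: vec_eq_iff)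
  show "inj ?A" by (rule injI) (auto simp: vec_eq_iff split: if_splits)
  show "corner_chart a b \<sigma> = (\<lambda>x. (\<chi> i. if \<sigma> i then a$i else b$i) + ?A x)"
    by (auto simp: fun_eq_iff corner_chart_def vec_eq_iff)
qed

lemma continuous_on_corner_chart: "continuous_on A (corner_chart a b \<sigma>)"
proof -
  obtain L c where L: "bounded_linear L" and eq: "corner_chart a b \<sigma> = (\<lambda>x. c + L x)"
    by (rule corner_chart_affine)
  show ?thesis unfolding eq
    by (intro continuous_on_add continuous_on_const linear_continuous_on L)
qed

lemma continuous_on_corner_chart_inv: "continuous_on A (corner_chart_inv a b \<sigma>)"
proof -
  have "continuous_on A (\<lambda>y. if \<sigma> i then y$i - a$i else b$i - y$i)" for i
    by (cases "\<sigma> i") (auto intro!: continuous_intros)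
  then show ?thesis unfolding corner_chart_inv_def by (intro continuous_on_vec_lambda)
qed

lemma corner_chart_inverse [simp]:
  "corner_chart_inv a b \<sigma> (corner_chart a b \<sigma> x) = x"
  "corner_chart a b \<sigma> (corner_chart_inv a b \<sigma> y) = y"
  by (simp_all add: corner_chart_def corner_chart_inv_def vec_eq_iff)

lemma local_immersion_affine:
  fixes G :: "real ^ 2 \<Rightarrow> 'b::euclidean_space"
  assumes G: "smooth_on G UNIV" and inj: "\<And>x. inj (frechet_derivative G (at x))"
    and A: "bounded_linear A" "inj A"
  shows "local_immersion W (\<lambda>x. G (c + A x))"
proof -
  have d: "((\<lambda>x. c + A x) has_derivative A) (at x)" for x
    by (auto intro!: derivative_eq_intros bounded_linear.has_derivative[OF A(1)])
  have "Ck_on (Suc 0) G UNIV" using G unfolding smooth_on_def by blast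
  then have G1: "G differentiable (at y)" for y by simp
  have "frechet_derivative (\<lambda>x. G (c + A x)) (at x) = frechet_derivative G (at (c + A x)) \<circ> A" for x
    using frechet_derivative_compose[OF differentiableI[OF d] G1, of x]
    by (simp add: o_def frechet_derivative_at[OF d, symmetric])
  then have "inj (frechet_derivative (\<lambda>x. G (c + A x)) (at x))" for x
    using inj A(2) by (simp add: inj_compose)
  moreover have "smooth_on (\<lambda>x. G (c + A x)) UNIV"
    using G unfolding smooth_on_def by (blast intro: Ck_on_affine[OF A(1)])
  ultimately show ?thesis
    unfolding local_immersion_def by (intro exI[of _ UNIV] exI[of _ "\<lambda>x. G (c + A x)"]) auto
qed

text \<open>
  A chart that starts at a corner reaches every point of the rectangle outside the two opposite
  sides. Since \<open>a$i < b$i\<close>, no point lies on both sides that are orthogonal to an axis, so every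
  point is reached from some corner.
\<close>

lemma rectangle_surface_immersion:
  fixes G :: "real ^ 2 \<Rightarrow> 'b::euclidean_space"
  assumes G: "smooth_on G UNIV" "\<And>x. inj (frechet_derivative G (at x))"
    and ab: "\<And>i. a$i < b$i"
  shows "surface_immersion (plane_embedding ` cbox a b) (G \<circ> plane_projection)"
  unfolding surface_immersion_def
proof
  fix p assume "p \<in> plane_embedding ` cbox a b"
  then obtain x where p: "p = plane_embedding x" and x: "x \<in> cbox a b" by blast
  \<comment> \<open>Start at the lower end of a coordinate unless the point lies at its upper end.\<close>
  define \<sigma> where "\<sigma> i \<longleftrightarrow> x$i < b$i" for i
  define O' where "O' = {y :: real^2. \<forall>i. y$i < b$i - a$i}"
  define W where "W = quadrant \<inter> O'"
  define \<psi> where "\<psi> = plane_embedding \<circ> corner_chart a b \<sigma>"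
  define \<psi>' where "\<psi>' = corner_chart_inv a b \<sigma> \<circ> plane_projection"
  have inv: "\<psi>' (\<psi> y) = y" for y by (simp add: \<psi>_def \<psi>'_def)
  have openO: "open O'"
    unfolding O'_def forall_2 by (intro open_Collect_conj open_Collect_less continuous_intros)
  have cont: "continuous_on A \<psi>" "continuous_on B \<psi>'" for A B
    unfolding \<psi>_def \<psi>'_def
    by (intro continuous_on_compose continuous_on_plane_embedding continuous_on_corner_chart
        continuous_on_plane_projection continuous_on_corner_chart_inv)+
  have mem: "corner_chart a b \<sigma> y \<in> cbox a b \<and> y \<in> O' \<longleftrightarrow> y \<in> W" for y
    by (auto simp: W_def quadrant_def O'_def mem_box_cart corner_chart_def forall_2
        split: if_splits)
  have img: "\<psi> ` W = plane_embedding ` cbox a b \<inter> \<psi>' -` O'"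
  proof (intro set_eqI iffI)
    fix z assume "z \<in> \<psi> ` W"
    then obtain y where "y \<in> W" "z = \<psi> y" by blast
    then show "z \<in> plane_embedding ` cbox a b \<inter> \<psi>' -` O'"
      using mem[of y] inv[of y] by (auto simp: \<psi>_def)
  next
    fix z assume z: "z \<in> plane_embedding ` cbox a b \<inter> \<psi>' -` O'"
    then obtain y where y: "y \<in> cbox a b" "z = plane_embedding y" by blast
    then have "z = \<psi> (\<psi>' z)" by (simp add: \<psi>_def \<psi>'_def)
    moreover have "\<psi>' z \<in> W" using mem[of "\<psi>' z"] z y by (simp add: \<psi>'_def)
    ultimately show "z \<in> \<psi> ` W" by blast
  qed
  have "openin (top_of_set quadrant) W" unfolding W_def using openO by blast
  moreover have "openin (top_of_set (plane_embedding ` cbox a b)) (\<psi> ` W)"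
    unfolding img using continuous_openin_preimage_gen[OF cont(2) openO] by simp
  moreover have "p \<in> \<psi> ` W"
    unfolding img p using x ab by (auto simp: \<psi>'_def O'_def corner_chart_inv_def \<sigma>_def mem_box_cart)
       (metis order.order_iff_strict)
  moreover have "homeomorphism W (\<psi> ` W) \<psi> \<psi>'"
    using cont inv by (auto simp: homeomorphism_def image_image)
  moreover have "local_immersion W (G \<circ> plane_projection \<circ> \<psi>)"
  proof -
    obtain A c where "bounded_linear A" "inj A" "corner_chart a b \<sigma> = (\<lambda>x. c + A x)"
      by (rule corner_chart_affine)
    then show ?thesis using local_immersion_affine[OF G, of A] by (simp add: \<psi>_def o_def)
  qed
  ultimately show "\<exists>W \<psi> \<psi>'.
        openin (top_of_set quadrant) W \<and>
        openin (top_of_set (plane_embedding ` cbox a b)) (\<psi> ` W) \<and> p \<in> \<psi> ` W \<and>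
        homeomorphism W (\<psi> ` W) \<psi> \<psi>' \<and> local_immersion W (G \<circ> plane_projection \<circ> \<psi>)"
    by blast
qed

lemma immersed_surface_rectangle:
  fixes G :: "real ^ 2 \<Rightarrow> 'b::euclidean_space"
  assumes "smooth_on G UNIV" "\<And>x. inj (frechet_derivative G (at x))" "\<And>i. a$i < b$i"
  shows "immersed_surface (G ` cbox a b)"
proof -
  have "(G \<circ> plane_projection) ` plane_embedding ` cbox a b = G ` cbox a b"
    by (simp add: image_image)
  with rectangle_surface_immersion[OF assms] show ?thesis
    unfolding immersed_surface_def by (iprover intro: exI conjI)
qed

lemma smooth_on_imp_continuous_on: "smooth_on f U \<Longrightarrow> continuous_on U f"
  unfolding smooth_on_def by (drule spec[of _ 0]) simp

lemma embedded_surface_rectangle: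
  fixes G :: "real ^ 2 \<Rightarrow> 'b::euclidean_space"
  assumes G: "smooth_on G UNIV" "\<And>x. inj (frechet_derivative G (at x))" "\<And>i. a$i < b$i"
    and inj: "inj_on G (cbox a b)"
  shows "embedded_surface (G ` cbox a b)"
proof -
  let ?M = "plane_embedding ` cbox a b" and ?f = "G \<circ> plane_projection"
  have "compact ?M"
    by (intro compact_continuous_image continuous_on_plane_embedding compact_cbox)
  moreover have "continuous_on ?M ?f"
    using smooth_on_imp_continuous_on[OF G(1)]
    by (intro continuous_on_compose continuous_on_plane_projection) (rule continuous_on_subset, auto)
  moreover have "?f ` ?M = G ` cbox a b" by (simp add: image_comp o_def)
  moreover have "inj_on ?f ?M" using inj by (auto simp: inj_on_def)
  ultimately obtain g where "homeomorphism ?M (G ` cbox a b) ?f g"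
    using homeomorphism_compact[of ?M ?f "G ` cbox a b"] by blast
  with rectangle_surface_immersion[OF G] show ?thesis
    unfolding embedded_surface_def by (iprover intro: exI conjI)
qed

text \<open>
  A neighbourhood in \<open>S\<close> that is homeomorphic to an open set \<open>D\<close> of the plane is carried by \<open>H\<close> to
  a subset of \<open>R\<close>, which is then an injective continuous image of \<open>D\<close> in the plane. By invariance of
  domain it is open, so the points in it are interior to \<open>R\<close>.
\<close>

lemma surface_boundary_homeomorphism:
  fixes G :: "real ^ 2 \<Rightarrow> 'b::euclidean_space"
  assumes hom: "homeomorphism R S G H"
  shows "surface_boundary S = G ` (R - interior R)"
proof -
  have "(\<exists>V (D :: (real ^ 2) set). openin (top_of_set S) V \<and> G x \<in> V \<and> open D \<and> V homeomorphic D)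
      \<longleftrightarrow> x \<in> interior R" (is "?L \<longleftrightarrow> _") if x: "x \<in> R" for x
  proof
    assume ?L
    then obtain V and D :: "(real ^ 2) set" where
      V: "openin (top_of_set S) V" "G x \<in> V" and D: "open D" and "V homeomorphic D"
      by blast
    then obtain f g where "homeomorphism V D g f" unfolding homeomorphic_def by blast
    then have fg: "homeomorphism D V f g" by (rule homeomorphism_symD)
    have VS: "V \<subseteq> S" using V(1) openin_imp_subset by blast
    have "homeomorphism V (H ` V) H G"
      using homeomorphism_of_subsets[OF homeomorphism_symD[OF hom] VS order_refl refl] .
    from homeomorphism_compose[OF fg this] have Hf: "homeomorphism D (H ` V) (H \<circ> f) (g \<circ> G)" .
    then have "continuous_on D (H \<circ> f)" "(H \<circ> f) ` D = H ` V" "inj_on (H \<circ> f) D"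
      unfolding homeomorphism_def by (blast, blast, metis inj_on_inverseI)
    then have "open (H ` V)" using invariance_of_domain[OF _ D] by metis
    moreover have "H ` V \<subseteq> R"
      using image_mono[OF VS, of H] homeomorphism_image2[OF hom] by simp
    moreover have "x \<in> H ` V"
      using imageI[OF V(2), of H] homeomorphism_apply1[OF hom x] by simp
    ultimately show "x \<in> interior R" by (meson interiorI)
  next
    assume x: "x \<in> interior R"
    have "openin (top_of_set S) (G ` interior R)"
      by (rule homeomorphism_imp_open_map[OF hom])
        (simp add: openin_open_eq interior_subset open_subset)
    moreover have "homeomorphism (interior R) (G ` interior R) G H"
      using homeomorphism_of_subsets[OF hom interior_subset order_refl refl] .
    then have "G ` interior R homeomorphic interior R"
      unfolding homeomorphic_def by (blast intro: homeomorphism_symD)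
    ultimately show ?L using x open_interior by blast
  qed
  moreover have "S = G ` R" using hom by (simp add: homeomorphism_def)
  ultimately show ?thesis unfolding surface_boundary_def by auto
qed

lemma surface_boundary_rectangle:
  fixes G :: "real ^ 2 \<Rightarrow> 'b::euclidean_space"
  assumes "continuous_on (cbox a b) G" "inj_on G (cbox a b)"
  shows "surface_boundary (G ` cbox a b) = G ` (cbox a b - box a b)"
proof -
  obtain H where "homeomorphism (cbox a b) (G ` cbox a b) G H"
    using homeomorphism_compact[OF compact_cbox assms(1) refl assms(2)] by blast
  then show ?thesis using surface_boundary_homeomorphism by fastforce
qed

section \<open>The product of two circular arcs\<close>

lemma minkowski_prod_carc_eq:
  "carc c1 \<phi>1 \<delta>1 \<otimes> carc c2 \<phi>2 \<delta>2 =
    qexp_surface c1 c2 ` cbox (vector [\<phi>1 - \<delta>1, \<phi>2 - \<delta>2]) (vector [\<phi>1 + \<delta>1, \<phi>2 + \<delta>2])"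
    (is "?L = ?R")
proof (intro set_eqI iffI)
  fix q assume "q \<in> ?L"
  then obtain s t where st: "q = qexp s c1 \<cdot> qexp t c2" "\<bar>s - \<phi>1\<bar> \<le> \<delta>1" "\<bar>t - \<phi>2\<bar> \<le> \<delta>2"
    by (auto simp: minkowski_prod_def carc_def)
  then show "q \<in> ?R"
    by (intro image_eqI[of _ _ "vector [s, t]"])
      (auto simp: qexp_surface_def mem_box_cart forall_2)
next
  fix q assume "q \<in> ?R"
  then obtain x :: "real ^ 2" where "q = qexp (x$1) c1 \<cdot> qexp (x$2) c2" "\<bar>x$1 - \<phi>1\<bar> \<le> \<delta>1" "\<bar>x$2 - \<phi>2\<bar> \<le> \<delta>2"
    by (auto simp: qexp_surface_def mem_box_cart forall_2 abs_le_iff)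
  then show "q \<in> ?L" unfolding minkowski_prod_def carc_def by blast
qed

lemma minkowski_prod_carc_subset_S3:
  assumes "imaginary_unit c1" "imaginary_unit c2"
  shows "carc c1 \<phi>1 \<delta>1 \<otimes> carc c2 \<phi>2 \<delta>2 \<subseteq> S3"
  using assms by (auto simp: minkowski_prod_def carc_def norm_qmult norm_qexp)

text \<open>
  A cap with centre \<open>P\<close> is a superlevel set of the inner product with \<open>P\<close>, so it includes \<open>S\<close> if and
  only if it contains a point \<open>U\<close> of \<open>S\<close> at which this inner product is least. The cap with \<open>U\<close> on
  its rim is the smallest one.
\<close>

lemma smallest_cap_radius_arccos:
  assumes P: "P \<in> S3" and S: "S \<subseteq> S3" and U: "U \<in> S" "\<And>V. V \<in> S \<Longrightarrow> U \<bullet> P \<le> V \<bullet> P"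
  shows "smallest_cap_radius P S (arccos (U \<bullet> P))"
proof -
  have "norm U = 1" "norm P = 1" using P S U(1) by auto
  then have r: "- 1 \<le> U \<bullet> P" "U \<bullet> P \<le> 1"
    using Cauchy_Schwarz_ineq2[of U P] by (simp_all add: abs_le_iff)
  have "arccos (U \<bullet> P) \<le> \<eta>" if "\<eta> \<in> {0..pi}" "S \<subseteq> sph_cap P \<eta>" for \<eta>
  proof -
    have "cos \<eta> \<le> U \<bullet> P" using that(2) U(1) by (auto simp: sph_cap_def)
    then have "arccos (U \<bullet> P) \<le> arccos (cos \<eta>)"
      using r by (intro arccos_le_arccos) auto
    then show ?thesis using that(1) by (simp add: arccos_cos)
  qed
  moreover have "S \<subseteq> sph_cap P (arccos (U \<bullet> P))"
    using S U(2) r by (auto simp: sph_cap_def cos_arccos)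
  ultimately show ?thesis
    using r by (simp add: smallest_cap_radius_def arccos_lbound arccos_ubound)
qed

lemma smallest_cap_radius_carc_prod:
  assumes c: "imaginary_unit c1" "imaginary_unit c2" and \<delta>: "0 \<le> \<delta>1" "0 \<le> \<delta>2"
  shows "\<exists>r. r \<in> {cos s * cos t - sin s * sin t * (c1 \<bullet> c2) | s t. \<bar>s\<bar> \<le> \<delta>1 \<and> \<bar>t\<bar> \<le> \<delta>2} \<and>
          (\<forall>s t. \<bar>s\<bar> \<le> \<delta>1 \<and> \<bar>t\<bar> \<le> \<delta>2 \<longrightarrow> r \<le> cos s * cos t - sin s * sin t * (c1 \<bullet> c2)) \<and>
          smallest_cap_radius (qexp \<phi>1 c1 \<cdot> qexp \<phi>2 c2)
            (carc c1 \<phi>1 \<delta>1 \<otimes> carc c2 \<phi>2 \<delta>2) (arccos r)"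
proof -
  let ?P = "qexp \<phi>1 c1 \<cdot> qexp \<phi>2 c2"
  let ?U = "\<lambda>s t. qexp (\<phi>1 + s) c1 \<cdot> qexp (\<phi>2 + t) c2"
  define h where "h s t = cos s * cos t - sin s * sin t * (c1 \<bullet> c2)" for s t
  let ?K = "{-\<delta>1..\<delta>1} \<times> {-\<delta>2..\<delta>2}"
  have "compact ?K" "?K \<noteq> {}" "continuous_on ?K (\<lambda>z. h (fst z) (snd z))"
    using \<delta> by (auto simp: h_def intro!: compact_Times continuous_intros)
  then obtain z where z: "z \<in> ?K" "\<And>y. y \<in> ?K \<Longrightarrow> h (fst z) (snd z) \<le> h (fst y) (snd y)"
    using continuous_attains_inf[of ?K "\<lambda>z. h (fst z) (snd z)"] by blast
  obtain s0 t0 where st: "z = (s0, t0)" by (cases z)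
  have bd: "\<bar>s0\<bar> \<le> \<delta>1" "\<bar>t0\<bar> \<le> \<delta>2" using z(1) by (auto simp: st)
  have min: "h s0 t0 \<le> h s t" if "\<bar>s\<bar> \<le> \<delta>1" "\<bar>t\<bar> \<le> \<delta>2" for s t
    using z(2)[of "(s, t)"] that by (simp add: st abs_le_iff minus_le_iff)
  have inner: "?U s t \<bullet> ?P = h s t" for s t
    unfolding h_def by (rule qexp_prod_inner_centre[OF c])
  have mem: "?U s0 t0 \<in> carc c1 \<phi>1 \<delta>1 \<otimes> carc c2 \<phi>2 \<delta>2"
    using bd unfolding minkowski_prod_def carc_def by fastforce
  have lower: "?U s0 t0 \<bullet> ?P \<le> V \<bullet> ?P" if V: "V \<in> carc c1 \<phi>1 \<delta>1 \<otimes> carc c2 \<phi>2 \<delta>2" for V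
  proof -
    obtain s t where "V = qexp s c1 \<cdot> qexp t c2" "\<bar>s - \<phi>1\<bar> \<le> \<delta>1" "\<bar>t - \<phi>2\<bar> \<le> \<delta>2"
      using V by (auto simp: minkowski_prod_def carc_def)
    then show ?thesis using min[of "s - \<phi>1" "t - \<phi>2"] inner[of "s - \<phi>1" "t - \<phi>2"] inner[of s0 t0]
      by simp
  qed
  have "?P \<in> S3" using c by (simp add: norm_qmult norm_qexp)
  from smallest_cap_radius_arccos[OF this minkowski_prod_carc_subset_S3[OF c] mem lower]
  have "smallest_cap_radius ?P (carc c1 \<phi>1 \<delta>1 \<otimes> carc c2 \<phi>2 \<delta>2) (arccos (h s0 t0))"
    unfolding inner .
  then show ?thesis using bd min unfolding h_def by blast
qed

lemma circular_arc_qexp: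
  assumes u: "norm u = 1" and v: "norm v = 1" and "u \<bullet> v = 0" and "a < b" "b < a + 2 * pi"
    and f: "\<And>t. f t = cos t *\<^sub>R u + sin t *\<^sub>R v"
  shows "circular_arc (f ` {a..b})"
  unfolding circular_arc_def
  by (intro exI[of _ 0] exI[of _ u] exI[of _ v] exI[of _ 1] exI[of _ a] exI[of _ b])
    (use assms in auto)

text \<open>
  A unit quaternion \<open>p\<close> maps the orthonormal pair \<open>1\<close>, \<open>c\<close> to an orthonormal pair, in whose plane
  the curve runs around the unit circle; the lemma after this one is its mirror image.
\<close>

lemma circular_arc_qmult_left:
  assumes p: "norm p = 1" and c: "imaginary_unit c" and ab: "a < b" "b < a + 2 * pi"
  shows "circular_arc ((\<lambda>t. p \<cdot> qexp t c) ` {a..b})"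
proof (rule circular_arc_qexp[OF p _ _ ab])
  show "norm (p \<cdot> c) = 1" using p c by (simp add: norm_qmult imaginary_unit_def)
  show "p \<bullet> (p \<cdot> c) = 0"
    using qmult_inner_left[of p qone c] imaginary_unit_inner_one[OF c] by simp
qed (simp add: qexp_def qmult_distribs)

lemma circular_arc_qmult_right:
  assumes p: "norm p = 1" and c: "imaginary_unit c" and ab: "a < b" "b < a + 2 * pi"
  shows "circular_arc ((\<lambda>t. qexp t c \<cdot> p) ` {a..b})"
proof (rule circular_arc_qexp[OF p _ _ ab])
  show "norm (c \<cdot> p) = 1" using p c by (simp add: norm_qmult imaginary_unit_def)
  show "p \<bullet> (c \<cdot> p) = 0"
    using qmult_inner_right[of qone p c] imaginary_unit_inner_one[OF c] by simp
qed (simp add: qexp_def qmult_distribs)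

text \<open>
  Two parameters in an interval of half length \<open>\<delta>\<close> differ by at most \<open>2 \<delta>\<close>, so \<open>\<delta>1, \<delta>2 < \<pi>\<close> excludes
  differences of \<open>2 \<pi>\<close>, and a half length below \<open>\<pi> / 2\<close> excludes a simultaneous shift of both
  parameters by \<open>\<pi>\<close>.
\<close>

lemma carc_prod_inj:
  assumes c: "imaginary_unit c1" "imaginary_unit c2" "c2 \<noteq> c1" "c2 \<noteq> - c1"
    and \<delta>: "\<delta>1 < pi" "\<delta>2 < pi" "\<delta>1 < pi / 2 \<or> \<delta>2 < pi / 2"
    and eq: "qexp s c1 \<cdot> qexp t c2 = qexp s' c1 \<cdot> qexp t' c2"
    and st: "s \<in> {\<phi>1 - \<delta>1..\<phi>1 + \<delta>1}" "s' \<in> {\<phi>1 - \<delta>1..\<phi>1 + \<delta>1}"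
      "t \<in> {\<phi>2 - \<delta>2..\<phi>2 + \<delta>2}" "t' \<in> {\<phi>2 - \<delta>2..\<phi>2 + \<delta>2}"
  shows "s = s' \<and> t = t'"
proof -
  have "\<bar>s - s'\<bar> \<le> 2 * \<delta>1" "\<bar>t - t'\<bar> \<le> 2 * \<delta>2" using st by auto
  then show ?thesis using \<delta> by (intro qexp_prod_inj[OF c eq]) auto
qed

lemma carc_prod_inj_on:
  assumes c: "imaginary_unit c1" "imaginary_unit c2" "c2 \<noteq> c1" "c2 \<noteq> - c1"
    and \<delta>: "\<delta>1 < pi" "\<delta>2 < pi" "\<delta>1 < pi / 2 \<or> \<delta>2 < pi / 2"
  shows "inj_on (qexp_surface c1 c2)
    (cbox (vector [\<phi>1 - \<delta>1, \<phi>2 - \<delta>2]) (vector [\<phi>1 + \<delta>1, \<phi>2 + \<delta>2]))"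
proof (rule inj_onI)
  fix x y :: "real ^ 2"
  assume xy: "x \<in> cbox (vector [\<phi>1 - \<delta>1, \<phi>2 - \<delta>2]) (vector [\<phi>1 + \<delta>1, \<phi>2 + \<delta>2])"
    "y \<in> cbox (vector [\<phi>1 - \<delta>1, \<phi>2 - \<delta>2]) (vector [\<phi>1 + \<delta>1, \<phi>2 + \<delta>2])"
    and eq: "qexp_surface c1 c2 x = qexp_surface c1 c2 y"
  have "x$1 = y$1 \<and> x$2 = y$2"
    by (rule carc_prod_inj[OF c \<delta> eq[unfolded qexp_surface_def], of \<phi>1 \<phi>2])
      (use xy in \<open>auto simp: mem_box_cart forall_2\<close>)
  then show "x = y" by (simp add: vec_eq_iff forall_2)
qed

text \<open>
  The witnesses are the images of the four sides of the parameter rectangle: \<open>A\<close> and \<open>A'\<close> belong to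
  the values \<open>\<phi>1 \<plusminus> \<delta>1\<close> of the first parameter, \<open>B\<close> and \<open>B'\<close> to the values \<open>\<phi>2 \<plusminus> \<delta>2\<close> of the second
  one. By injectivity they meet as the sides do.
\<close>

lemma carc_prod_boundary:
  assumes c: "imaginary_unit c1" "imaginary_unit c2" "c2 \<noteq> c1" "c2 \<noteq> - c1"
    and \<delta>0: "0 < \<delta>1" "0 < \<delta>2"
    and \<delta>: "\<delta>1 < pi" "\<delta>2 < pi" "\<delta>1 < pi / 2 \<or> \<delta>2 < pi / 2"
  shows "\<exists>A A' B B'.
           circular_arc A \<and> circular_arc A' \<and> circular_arc B \<and> circular_arc B' \<and>
           surface_boundary (carc c1 \<phi>1 \<delta>1 \<otimes> carc c2 \<phi>2 \<delta>2) = A \<union> A' \<union> B \<union> B' \<and>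
           A \<inter> B = {qexp (\<phi>1 + \<delta>1) c1 \<cdot> qexp (\<phi>2 + \<delta>2) c2} \<and>
           A' \<inter> B' = {qexp (\<phi>1 - \<delta>1) c1 \<cdot> qexp (\<phi>2 - \<delta>2) c2} \<and>
           A \<inter> B' = {qexp (\<phi>1 + \<delta>1) c1 \<cdot> qexp (\<phi>2 - \<delta>2) c2} \<and>
           A' \<inter> B = {qexp (\<phi>1 - \<delta>1) c1 \<cdot> qexp (\<phi>2 + \<delta>2) c2} \<and>
           A \<inter> A' = {} \<and> B \<inter> B' = {}"
proof -
  define I where "I = {\<phi>1 - \<delta>1..\<phi>1 + \<delta>1}"
  define J where "J = {\<phi>2 - \<delta>2..\<phi>2 + \<delta>2}"
  define E where "E s = (\<lambda>t. qexp s c1 \<cdot> qexp t c2) ` J" for s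
  define F where "F t = (\<lambda>s. qexp s c1 \<cdot> qexp t c2) ` I" for t
  let ?a = "vector [\<phi>1 - \<delta>1, \<phi>2 - \<delta>2] :: real ^ 2"
  let ?b = "vector [\<phi>1 + \<delta>1, \<phi>2 + \<delta>2] :: real ^ 2"
  let ?G = "qexp_surface c1 c2"
  have inj: "s = s' \<and> t = t'"
    if "qexp s c1 \<cdot> qexp t c2 = qexp s' c1 \<cdot> qexp t' c2" "s \<in> I" "s' \<in> I" "t \<in> J" "t' \<in> J"
    for s s' t t'
    using carc_prod_inj[OF c \<delta> that(1)] that(2-) unfolding I_def J_def by blast
  have ends: "\<phi>1 - \<delta>1 \<in> I" "\<phi>1 + \<delta>1 \<in> I" "\<phi>2 - \<delta>2 \<in> J" "\<phi>2 + \<delta>2 \<in> J"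
    using \<delta>0 by (auto simp: I_def J_def)
  have arcs: "circular_arc (E s)" "circular_arc (F t)" for s t
    unfolding E_def F_def I_def J_def using c \<delta>0 \<delta>
    by (auto intro!: circular_arc_qmult_left circular_arc_qmult_right norm_qexp)
  have EF: "E s \<inter> F t = {qexp s c1 \<cdot> qexp t c2}" if "s \<in> I" "t \<in> J" for s t
    unfolding E_def F_def using that by (auto dest!: inj)
  have EE: "E s \<inter> E s' = {}" if "s \<in> I" "s' \<in> I" "s \<noteq> s'" for s s'
    unfolding E_def using that by (auto dest!: inj)
  have FF: "F t \<inter> F t' = {}" if "t \<in> J" "t' \<in> J" "t \<noteq> t'" for t t'
    unfolding F_def using that by (auto dest!: inj)
  have box: "x \<in> cbox ?a ?b \<longleftrightarrow> x$1 \<in> I \<and> x$2 \<in> J" for x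
    by (auto simp: mem_box_cart forall_2 I_def J_def)
  have "inj_on ?G (cbox ?a ?b)" by (rule carc_prod_inj_on[OF c \<delta>])
  moreover have "continuous_on (cbox ?a ?b) ?G"
    using smooth_on_imp_continuous_on[OF smooth_qexp_surface] continuous_on_subset by blast
  ultimately have "surface_boundary (carc c1 \<phi>1 \<delta>1 \<otimes> carc c2 \<phi>2 \<delta>2)
      = ?G ` (cbox ?a ?b - box ?a ?b)"
    unfolding minkowski_prod_carc_eq by (intro surface_boundary_rectangle)
  also have "\<dots> = E (\<phi>1 + \<delta>1) \<union> E (\<phi>1 - \<delta>1) \<union> F (\<phi>2 + \<delta>2) \<union> F (\<phi>2 - \<delta>2)" (is "?L = ?R")
  proof (intro set_eqI iffI)
    fix q assume "q \<in> ?L"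
    then obtain x where x: "q = qexp (x$1) c1 \<cdot> qexp (x$2) c2" "x$1 \<in> I" "x$2 \<in> J"
        "x \<notin> box ?a ?b"
      by (auto simp: box qexp_surface_def)
    from x(2-) have "x$1 = \<phi>1 + \<delta>1 \<or> x$1 = \<phi>1 - \<delta>1 \<or> x$2 = \<phi>2 + \<delta>2 \<or> x$2 = \<phi>2 - \<delta>2"
      by (auto simp: mem_box_cart forall_2 I_def J_def)
    then show "q \<in> ?R" using x(1-3) by (auto simp: E_def F_def)
  next
    fix q assume "q \<in> ?R"
    then obtain s t where st: "q = qexp s c1 \<cdot> qexp t c2" "s \<in> I" "t \<in> J"
        "s = \<phi>1 + \<delta>1 \<or> s = \<phi>1 - \<delta>1 \<or> t = \<phi>2 + \<delta>2 \<or> t = \<phi>2 - \<delta>2"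
      using ends by (auto simp: E_def F_def)
    have "vector [s, t] \<in> cbox ?a ?b - box ?a ?b"
      using st(2-) by (auto simp: box) (auto simp: mem_box_cart forall_2)
    then show "q \<in> ?L"
      by (rule rev_image_eqI) (simp add: st(1) qexp_surface_def)
  qed
  finally have "surface_boundary (carc c1 \<phi>1 \<delta>1 \<otimes> carc c2 \<phi>2 \<delta>2) = ?R" .
  then show ?thesis
    using arcs EF ends EE[OF ends(2,1)] FF[OF ends(4,3)] \<delta>0
    by (intro exI[of _ "E (\<phi>1 + \<delta>1)"] exI[of _ "E (\<phi>1 - \<delta>1)"]
        exI[of _ "F (\<phi>2 + \<delta>2)"] exI[of _ "F (\<phi>2 - \<delta>2)"]) auto
qed

theorem theorem2:
  fixes c1 c2 :: quat and \<phi>1 \<phi>2 \<delta>1 \<delta>2 :: real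
  assumes "imaginary_unit c1" and "imaginary_unit c2" and "c2 \<noteq> c1" and "c2 \<noteq> - c1"
    and "\<delta>1 \<in> {0..pi}" and "\<delta>2 \<in> {0..pi}"
  shows
    "carc c1 \<phi>1 \<delta>1 \<otimes> carc c2 \<phi>2 \<delta>2 \<subseteq> S3 \<and>
     (0 < \<delta>1 \<and> 0 < \<delta>2 \<longrightarrow> immersed_surface (carc c1 \<phi>1 \<delta>1 \<otimes> carc c2 \<phi>2 \<delta>2)) \<and>
     (\<exists>r. r \<in> {cos s * cos t - sin s * sin t * (c1 \<bullet> c2) | s t. \<bar>s\<bar> \<le> \<delta>1 \<and> \<bar>t\<bar> \<le> \<delta>2} \<and>
          (\<forall>s t. \<bar>s\<bar> \<le> \<delta>1 \<and> \<bar>t\<bar> \<le> \<delta>2 \<longrightarrow> r \<le> cos s * cos t - sin s * sin t * (c1 \<bullet> c2)) \<and>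
          smallest_cap_radius (qexp \<phi>1 c1 \<cdot> qexp \<phi>2 c2)
            (carc c1 \<phi>1 \<delta>1 \<otimes> carc c2 \<phi>2 \<delta>2) (arccos r)) \<and>
     (0 < \<delta>1 \<and> 0 < \<delta>2 \<and> \<delta>1 \<noteq> pi \<and> \<delta>2 \<noteq> pi \<and> (\<delta>1 < pi / 2 \<or> \<delta>2 < pi / 2) \<longrightarrow>
        embedded_surface (carc c1 \<phi>1 \<delta>1 \<otimes> carc c2 \<phi>2 \<delta>2) \<and>
        (\<exists>A A' B B'.
           circular_arc A \<and> circular_arc A' \<and> circular_arc B \<and> circular_arc B' \<and>
           surface_boundary (carc c1 \<phi>1 \<delta>1 \<otimes> carc c2 \<phi>2 \<delta>2) = A \<union> A' \<union> B \<union> B' \<and>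
           A \<inter> B = {qexp (\<phi>1 + \<delta>1) c1 \<cdot> qexp (\<phi>2 + \<delta>2) c2} \<and>
           A' \<inter> B' = {qexp (\<phi>1 - \<delta>1) c1 \<cdot> qexp (\<phi>2 - \<delta>2) c2} \<and>
           A \<inter> B' = {qexp (\<phi>1 + \<delta>1) c1 \<cdot> qexp (\<phi>2 - \<delta>2) c2} \<and>
           A' \<inter> B = {qexp (\<phi>1 - \<delta>1) c1 \<cdot> qexp (\<phi>2 + \<delta>2) c2} \<and>
           A \<inter> A' = {} \<and> B \<inter> B' = {}))"
proof -
  note c = assms(1-4)
  let ?S = "carc c1 \<phi>1 \<delta>1 \<otimes> carc c2 \<phi>2 \<delta>2"
  let ?a = "vector [\<phi>1 - \<delta>1, \<phi>2 - \<delta>2] :: real ^ 2"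
  let ?b = "vector [\<phi>1 + \<delta>1, \<phi>2 + \<delta>2] :: real ^ 2"
  note immersion = smooth_qexp_surface[of c1 c2] qexp_surface_derivative_inj[OF c]
  have nondegenerate: "?a $ i < ?b $ i" if "0 < \<delta>1" "0 < \<delta>2" for i
    using that exhaust_2[of i] by auto
  have immersed: "immersed_surface ?S" if "0 < \<delta>1" "0 < \<delta>2"
    unfolding minkowski_prod_carc_eq
    by (intro immersed_surface_rectangle immersion nondegenerate that)
  have embedded: "embedded_surface ?S"
    if "0 < \<delta>1" "0 < \<delta>2" "\<delta>1 < pi" "\<delta>2 < pi" "\<delta>1 < pi / 2 \<or> \<delta>2 < pi / 2"
    unfolding minkowski_prod_carc_eq
  proof (intro embedded_surface_rectangle immersion nondegenerate that(1,2))
    show "inj_on (qexp_surface c1 c2) (cbox ?a ?b)"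
      by (rule carc_prod_inj_on[OF c that(3-5)])
  qed
  have "\<delta>1 < pi" if "\<delta>1 \<noteq> pi" using that assms(5) by auto
  moreover have "\<delta>2 < pi" if "\<delta>2 \<noteq> pi" using that assms(6) by auto
  moreover have "0 \<le> \<delta>1" "0 \<le> \<delta>2" using assms(5,6) by auto
  ultimately show ?thesis
    by (intro conjI impI minkowski_prod_carc_subset_S3 smallest_cap_radius_carc_prod
        carc_prod_boundary immersed embedded c) auto
qed

end
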